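(* Let $H$ be a Hilbert space. For every integer $n\ge1$, every $N>1$, and every compact set $\mathcal K\subset H$ such that $\sup_{f\in\mathcal K}\|f\|_H=1$, $$d^{(N+1)}_{n+1}(\mathcal K)_H\le d_n(\mathcal K,N)_H\qquad\text{and}\qquad d^{3}_{n+\lceil\log_2N\rceil}(\mathcal K)_H\le d_n(\mathcal K,N)_H,$$ where $d_m^{\gamma}(\mathcal K)_H$ is the Lipschitz width with Lipschitz constant $\gamma$ (the superscripts $N+1$ and $3$ are Lipschitz constants) and $d_n(\mathcal K,N)_H$ is the nonlinear Kolmogorov width.
   Context: All linear spaces are over the real numbers. Let $X$ be a Banach (or Hilbert) space and $\mathcal K\subset X$ compact. Nonlinear Kolmogorov $(n,N)$-width, $N\ge1$ real, $n\ge1$: $$d_n(\mathcal K,N)_X=\inf_{\mathcal L_N}\ \sup_{f\in\mathcal K}\ \inf_{X_n\in\mathcal L_N}\operatorname{dist}(f,X_n)_X,$$ where the outer infimum is over all sets $\mathcal L_N$ of at most $N$ linear subspaces $X_n\subset X$ of dimension $n$. Lipschitz width: for a norm $\|\cdot\|_{Y_k}$ on $\mathbb R^k$, $k\ge 1$, let $B_{Y_k}=\{y\in\mathbb R^k:\|y\|_{Y_k}\le1\}$. For $\gamma\ge0$ let $$d^\gamma(\mathcal K,Y_k)_X=\inf_{\Phi_k}\ \sup_{f\in\mathcal K}\ \inf_{y\in B_{Y_k}}\|f-\Phi_k(y)\|_X,$$ where the infimum is over all maps $\Phi_k:B_{Y_k}\to X$ with $\|\Phi_k(y)-\Phi_k(y')\|_X\le\gamma\|y-y'\|_{Y_k}$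 for all $y,y'\in B_{Y_k}$. Then $$d_n^\gamma(\mathcal K)_X=\inf_{k\le n}\ \inf_{\|\cdot\|_{Y_k}}d^\gamma(\mathcal K,Y_k)_X,$$ the infimum being over all $1\le k\le n$ and all norms $\|\cdot\|_{Y_k}$ on $\mathbb R^k$. *)

theory Defs
  imports "HOL-Analysis.Analysis"
begin

text \<open>
  The widths take values in \<^typ>\<open>ennreal\<close>, so that every infimum and supremum is
  that of a complete lattice: the infimum over an empty family is \<open>\<infinity>\<close>, which occurs
  for the nonlinear Kolmogorov width when the ambient space has no subspace of
  dimension \<open>n\<close>.
\<close>

text \<open>
  The library sets \<open>dim V = 0\<close> for infinite-dimensional \<open>V\<close>, so \<open>dim V = n\<close> expresses
  "of (finite) dimension \<open>n\<close>" only for \<open>n \<ge> 1\<close>, the range in which the width is considered.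
\<close>
definition nonlinear_kolmogorov_width ::
    "nat \<Rightarrow> real \<Rightarrow> 'a::real_normed_vector set \<Rightarrow> ennreal" where
  "nonlinear_kolmogorov_width n N K =
     (INF L\<in>{L. finite L \<and> real (card L) \<le> N \<and> (\<forall>V\<in>L. subspace V \<and> dim V = n)}.
        SUP f\<in>K. INF V\<in>L. ennreal (infdist f V))"

text \<open>
  Since the dimension \<open>k\<close> varies inside the definition of the Lipschitz width, \<open>\<real>\<^sup>k\<close> is
  represented as \<open>topspace (Euclidean_space k) = {y :: nat \<Rightarrow> real. \<forall>i\<ge>k. y i = 0}\<close>; only
  its underlying set is used. Norms and maps are total functions of which only the values
  on \<open>\<real>\<^sup>k\<close>, respectively on the unit ball, matter.
\<close>
definition norm_on_Rk :: "nat \<Rightarrow> ((nat \<Rightarrow> real) \<Rightarrow> real) \<Rightarrow> bool" where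
  "norm_on_Rk k p \<longleftrightarrow>
     (\<forall>y\<in>topspace (Euclidean_space k). 0 \<le> p y \<and> (p y = 0 \<longleftrightarrow> y = (\<lambda>i. 0))) \<and>
     (\<forall>y\<in>topspace (Euclidean_space k). \<forall>c. p (\<lambda>i. c * y i) = \<bar>c\<bar> * p y) \<and>
     (\<forall>y\<in>topspace (Euclidean_space k). \<forall>z\<in>topspace (Euclidean_space k).
        p (\<lambda>i. y i + z i) \<le> p y + p z)"

definition unit_ball_Rk :: "nat \<Rightarrow> ((nat \<Rightarrow> real) \<Rightarrow> real) \<Rightarrow> (nat \<Rightarrow> real) set" where
  "unit_ball_Rk k p = {y \<in> topspace (Euclidean_space k). p y \<le> 1}"

definition lipschitz_maps ::
    "real \<Rightarrow> nat \<Rightarrow> ((nat \<Rightarrow> real) \<Rightarrow> real) \<Rightarrow> ((nat \<Rightarrow> real) \<Rightarrow> 'a::real_normed_vector) set" where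
  "lipschitz_maps \<gamma> k p =
     {\<Phi>. \<forall>y\<in>unit_ball_Rk k p. \<forall>z\<in>unit_ball_Rk k p.
           norm (\<Phi> y - \<Phi> z) \<le> \<gamma> * p (\<lambda>i. y i - z i)}"

definition fixed_lipschitz_width ::
    "real \<Rightarrow> nat \<Rightarrow> ((nat \<Rightarrow> real) \<Rightarrow> real) \<Rightarrow> 'a::real_normed_vector set \<Rightarrow> ennreal" where
  "fixed_lipschitz_width \<gamma> k p K =
     (INF \<Phi>\<in>lipschitz_maps \<gamma> k p. SUP f\<in>K. INF y\<in>unit_ball_Rk k p. ennreal (norm (f - \<Phi> y)))"

definition lipschitz_width :: "real \<Rightarrow> nat \<Rightarrow> 'a::real_normed_vector set \<Rightarrow> ennreal" where
  "lipschitz_width \<gamma> n K =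
     (INF k\<in>{1..n}. INF p\<in>{p. norm_on_Rk k p}. fixed_lipschitz_width \<gamma> k p K)"

end

theory Submission
  imports Defs
begin

text \<open>
  Let \<open>L\<close> be a family of at most \<open>N\<close> subspaces of dimension \<open>n\<close>. Since \<open>K\<close> lies in the unit
  ball of a Hilbert space, the best approximation of \<open>f \<in> K\<close> from \<open>V \<in> L\<close> is its orthogonal
  projection, which lies in the unit ball of \<open>V\<close>; and that ball is the image of the Euclidean
  ball of \<open>\<real>\<^sup>n\<close> under a linear isometry \<open>U\<^sub>V\<close>. It is therefore enough to find one Lipschitz map
  whose image contains all these unit balls. This is where \<open>m\<close> additional coordinates are spent:
  each \<open>V\<close> is assigned a point \<open>v\<^sub>V\<close> of the cube \<open>[-1, 1]\<^sup>m\<close>, and with the sup norm on the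
  additional coordinates one takes
  \<open>\<Phi> (x, t) = (\<Sum>V\<in>L. max 0 (1 - s * \<parallel>t - v\<^sub>V\<parallel>\<^sub>\<infinity>) *\<^sub>R U\<^sub>V x)\<close>.
  If the points \<open>v\<^sub>V\<close> have mutual distance at least \<open>2 / s\<close>, then no two bumps are positive at
  the same point, so \<open>\<Phi> (x, v\<^sub>V) = U\<^sub>V x\<close>. For the norm \<open>max (\<parallel>x\<parallel>\<^sub>2) (\<parallel>t\<parallel>\<^sub>\<infinity>)\<close> the map is Lipschitz with
  constant \<open>1 + s\<close>: the variation in \<open>x\<close> contributes \<open>1\<close>, because \<open>U\<^sub>V\<close> is an isometry and the
  bumps add up to at most \<open>1\<close>, and the variation in \<open>t\<close> contributes \<open>s\<close>, by
  \<open>sum_abs_diff_bump_le\<close>. The resulting estimate is \<open>lipschitz_width_le_separated_codes\<close>.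

  The two inequalities correspond to two codes. On the segment \<open>[-1, 1]\<close>, that is \<open>m = 1\<close>, there are
  enough points with spacing \<open>2 / N\<close>, so that \<open>s = N\<close>. For \<open>m = \<lceil>log\<^sub>2 N\<rceil>\<close> the cube has
  \<open>2\<^sup>m \<ge> N\<close> vertices, with mutual distance \<open>2\<close>, so that \<open>s = 2\<close> is admissible
  and gives the constant \<open>3\<close>.
\<close>

section \<open>Orthonormal bases and projections\<close>

text \<open>
  The Gram-Schmidt process of \<open>basis_orthogonal\<close> may produce zero vectors and returns at
  most \<open>n\<close> vectors; the dimension forces exactly \<open>n\<close> nonzero ones.
\<close>
lemma orthonormal_basis_of_dim:
  fixes V :: "'h::real_inner set"
  assumes "subspace V" and "dim V = n" and "n \<ge> 1"
  obtains e :: "nat \<Rightarrow> 'h"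
  where "\<And>i j. i < n \<Longrightarrow> j < n \<Longrightarrow> e i \<bullet> e j = (if i = j then 1 else 0)"
    and "V = span (e ` {..<n})"
proof -
  obtain B where B: "B \<subseteq> V" "V \<subseteq> span B" "card B = dim V"
    using basis_exists by metis
  \<comment> \<open>An infinite \<open>B\<close> would have cardinality \<open>0\<close>.\<close>
  have "finite B"
    using B(3) assms by (metis card.infinite not_one_le_zero)
  then obtain C where C: "finite C" "card C \<le> card B" "span C = span B" "pairwise orthogonal C"
    using basis_orthogonal by blast
  have V: "V = span C"
    using B C(3) assms(1) by (metis span_subspace)
  define D where "D = C - {0}"
  have "V = span D"
    unfolding D_def V by simp
  have "finite D" "card D \<le> n"
    using C B(3) assms(2) card_mono[of C D] by (auto simp: D_def)
  moreover have "n \<le> card D"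
    using dim_le_card[of V D] \<open>V = span D\<close> \<open>finite D\<close> assms(2) by auto
  ultimately obtain b where b: "bij_betw b {..<n} D"
    by (metis bij_betw_from_nat_into_finite order_antisym)
  define e where "e = (\<lambda>i. sgn (b i))"
  have nz: "b i \<in> C" "b i \<noteq> 0" if "i < n" for i
    using b that unfolding bij_betw_def D_def by blast+
  have "e i \<bullet> e j = (if i = j then 1 else 0)" if "i < n" "j < n" for i j
  proof (cases "i = j")
    case True
    then show ?thesis
      using nz[OF that(1)] by (simp add: e_def dot_square_norm norm_sgn)
  next
    case False
    then have "b i \<noteq> b j"
      using b that unfolding bij_betw_def inj_on_def by auto
    then have "b i \<bullet> b j = 0"
      using C(4) nz that unfolding pairwise_def orthogonal_def by blast
    then show ?thesis
      using False by (simp add: e_def sgn_div_norm)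
  qed
  moreover have "V = span (e ` {..<n})"
  proof
    have "b i \<in> span (e ` {..<n})" if "i < n" for i
    proof -
      have "b i = norm (b i) *\<^sub>R e i"
        using nz[OF that] by (simp add: e_def sgn_div_norm)
      then show ?thesis
        using that by (metis imageI lessThan_iff span_base span_mul)
    qed
    then have "D \<subseteq> span (e ` {..<n})"
      using b unfolding bij_betw_def by blast
    then show "V \<subseteq> span (e ` {..<n})"
      unfolding \<open>V = span D\<close> by (simp add: span_minimal)
    have "e i \<in> span C" if "i < n" for i
      using nz[OF that] by (simp add: e_def sgn_div_norm span_base span_mul)
    then show "span (e ` {..<n}) \<subseteq> V"
      unfolding V by (intro span_minimal) auto
  qed
  ultimately show ?thesis
    using that by blast
qed

context
  fixes e :: "nat \<Rightarrow> 'h::real_inner" and n :: nat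
  assumes orthonormal: "\<And>i j. i < n \<Longrightarrow> j < n \<Longrightarrow> e i \<bullet> e j = (if i = j then 1 else 0)"
begin

lemma inner_orthonormal_combination:
  assumes "j < n"
  shows "(\<Sum>i<n. c i *\<^sub>R e i) \<bullet> e j = c j"
proof -
  have "(\<Sum>i<n. c i *\<^sub>R e i) \<bullet> e j = (\<Sum>i<n. if i = j then c i else 0)"
    unfolding inner_sum_left by (intro sum.cong) (use assms orthonormal in auto)
  then show ?thesis
    using assms by simp
qed

lemma norm_orthonormal_combination: "norm (\<Sum>i<n. c i *\<^sub>R e i) = L2_set c {..<n}"
proof -
  have "(\<Sum>i<n. c i *\<^sub>R e i) \<bullet> (\<Sum>j<n. c j *\<^sub>R e j) = (\<Sum>j<n. (c j)\<^sup>2)"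
    unfolding inner_sum_right[where f = "\<lambda>j. c j *\<^sub>R e j"]
    by (intro sum.cong) (simp_all add: inner_orthonormal_combination power2_eq_square)
  then show ?thesis
    by (simp add: norm_eq_sqrt_inner L2_set_def)
qed

lemma orthogonal_projection_residual:
  assumes "v \<in> span (e ` {..<n})"
  shows "orthogonal (f - (\<Sum>i<n. (f \<bullet> e i) *\<^sub>R e i)) v"
proof (rule orthogonal_to_span[OF assms])
  show "orthogonal (f - (\<Sum>i<n. (f \<bullet> e i) *\<^sub>R e i)) y" if "y \<in> e ` {..<n}" for y
    using that by (auto simp: orthogonal_def inner_diff_left inner_orthonormal_combination)
qed

lemma orthonormal_combination_in_span: "(\<Sum>i<n. c i *\<^sub>R e i) \<in> span (e ` {..<n})"
  by (intro span_sum span_mul span_base) auto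

lemma bessel_inequality: "L2_set (\<lambda>i. f \<bullet> e i) {..<n} \<le> norm f"
proof -
  define p where "p = (\<Sum>i<n. (f \<bullet> e i) *\<^sub>R e i)"
  have "orthogonal (f - p) p"
    unfolding p_def by (intro orthogonal_projection_residual orthonormal_combination_in_span)
  then have "(norm f)\<^sup>2 = (norm (f - p))\<^sup>2 + (norm p)\<^sup>2"
    using norm_add_Pythagorean[of "f - p" p] by simp
  then have "norm p \<le> norm f"
    by (simp add: power2_le_imp_le)
  then show ?thesis
    by (simp add: p_def norm_orthonormal_combination)
qed

lemma norm_projection_residual_le_infdist:
  "norm (f - (\<Sum>i<n. (f \<bullet> e i) *\<^sub>R e i)) \<le> infdist f (span (e ` {..<n}))"
proof -
  define p where "p = (\<Sum>i<n. (f \<bullet> e i) *\<^sub>R e i)"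
  have "norm (f - p) \<le> dist f v" if v: "v \<in> span (e ` {..<n})" for v
  proof -
    have "p - v \<in> span (e ` {..<n})"
      unfolding p_def by (intro span_diff orthonormal_combination_in_span v)
    then have "orthogonal (f - p) (p - v)"
      unfolding p_def by (rule orthogonal_projection_residual)
    then have "(norm (f - v))\<^sup>2 = (norm (f - p))\<^sup>2 + (norm (p - v))\<^sup>2"
      using norm_add_Pythagorean[of "f - p" "p - v"] by simp
    then show ?thesis
      by (simp add: dist_norm power2_le_imp_le)
  qed
  moreover have "span (e ` {..<n}) \<noteq> {}"
    using span_zero by blast
  ultimately show ?thesis
    unfolding p_def[symmetric] by (simp add: infdist_notempty cINF_greatest)
qed

end

section \<open>Bumps around separated points\<close>

definition bump :: "real \<Rightarrow> real" where
  "bump r = max 0 (1 - r)"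

lemma bump_nonneg: "bump r \<ge> 0"
  by (simp add: bump_def)

lemma bump_diff_le: "\<bar>bump r - bump r'\<bar> \<le> \<bar>r - r'\<bar>"
  by (auto simp: bump_def)

text \<open>
  A pseudometric \<open>d\<close> has to be admitted, because the bumps will see only the coordinates \<open>t\<close> of a
  parameter \<open>(x, t)\<close>.
\<close>
context
  fixes d :: "'b \<Rightarrow> 'b \<Rightarrow> real" and s :: real and v :: "'a \<Rightarrow> 'b" and L :: "'a set"
  assumes d_commute: "\<And>x y. d x y = d y x"
    and d_triangle: "\<And>x y z. d x z \<le> d x y + d y z"
    and s_nonneg: "s \<ge> 0"
    and finite_L: "finite L"
    and separated: "\<And>V W. V \<in> L \<Longrightarrow> W \<in> L \<Longrightarrow> V \<noteq> W \<Longrightarrow> 2 \<le> s * d (v V) (v W)"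
begin

text \<open>
  Each bump has radius \<open>1 / s\<close>, and the centres are at least \<open>2 / s\<close> apart: the distance by which
  \<open>x\<close> and \<open>y\<close> lie inside two different bumps must be bridged between them. For \<open>x = y\<close> this is
  the disjointness of the bumps; in general it is what makes the passage from one bump to another Lipschitz
  with constant \<open>s\<close> rather than \<open>2 * s\<close>.
\<close>
lemma bump_heights_le:
  assumes "V \<in> L" "W \<in> L" "V \<noteq> W" "bump (s * d x (v V)) > 0" "bump (s * d y (v W)) > 0"
  shows "bump (s * d x (v V)) + bump (s * d y (v W)) \<le> s * d x y"
proof -
  have "d (v V) (v W) \<le> d x (v V) + d x y + d y (v W)"
    using d_triangle[of "v V" "v W" x] d_triangle[of x "v W" y] d_commute[of x "v V"] by linarith
  then have "s * d (v V) (v W) \<le> s * d x (v V) + s * d x y + s * d y (v W)"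
    using s_nonneg by (metis distrib_left mult_left_mono)
  then show ?thesis
    using separated[OF assms(1-3)] assms(4,5) by (auto simp: bump_def max_def split: if_splits)
qed

lemma bump_disjoint:
  assumes "d x x = 0" "V \<in> L" "W \<in> L" "bump (s * d x (v V)) > 0" "bump (s * d x (v W)) > 0"
  shows "V = W"
  using bump_heights_le[of V W x x] assms by force

lemma sum_bump_le_1:
  assumes "d x x = 0" and "\<And>V. V \<in> L \<Longrightarrow> d x (v V) \<ge> 0"
  shows "(\<Sum>V\<in>L. bump (s * d x (v V))) \<le> 1"
proof (cases "\<exists>A\<in>L. bump (s * d x (v A)) > 0")
  case True
  then obtain A where A: "A \<in> L" "bump (s * d x (v A)) > 0"
    by blast
  have "(\<Sum>V\<in>L. bump (s * d x (v V))) = (\<Sum>V\<in>{A}. bump (s * d x (v V)))"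
    by (rule sum.mono_neutral_right)
      (use A finite_L bump_disjoint[OF assms(1)] bump_nonneg in \<open>force simp: less_le\<close>)+
  also have "\<dots> \<le> 1"
    using assms(2)[OF A(1)] s_nonneg by (simp add: bump_def)
  finally show ?thesis .
next
  case False
  then have "(\<Sum>V\<in>L. bump (s * d x (v V))) = 0"
    using bump_nonneg by (intro sum.neutral) (force simp: less_le)
  then show ?thesis
    by simp
qed

text \<open>
  At most one bump is nonzero at \<open>x\<close>, and at most one at \<open>y\<close>. If they are different, the sum is the
  sum of the two heights, which \<open>bump_heights_le\<close> controls; otherwise a single term remains,
  and each bump is Lipschitz with constant \<open>s\<close>.
\<close>
lemma sum_abs_diff_bump_le:
  assumes "d x x = 0" "d y y = 0" "d x y \<ge> 0"
  shows "(\<Sum>V\<in>L. \<bar>bump (s * d x (v V)) - bump (s * d y (v V))\<bar>) \<le> s * d x y"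
proof -
  define a where "a = (\<lambda>V. bump (s * d x (v V)))"
  define b where "b = (\<lambda>V. bump (s * d y (v V)))"
  have nonneg: "a V \<ge> 0" "b V \<ge> 0" for V
    by (simp_all add: a_def b_def bump_nonneg)
  have a_unique: "V = W" if "V \<in> L" "W \<in> L" "a V > 0" "a W > 0" for V W
    using bump_disjoint[OF assms(1)] that unfolding a_def by blast
  have b_unique: "V = W" if "V \<in> L" "W \<in> L" "b V > 0" "b W > 0" for V W
    using bump_disjoint[OF assms(2)] that unfolding b_def by blast
  have "(\<Sum>V\<in>L. \<bar>a V - b V\<bar>) \<le> s * d x y"
  proof (cases "\<exists>A\<in>L. \<exists>B\<in>L. A \<noteq> B \<and> a A > 0 \<and> b B > 0")
    case True
    then obtain A B where AB: "A \<in> L" "B \<in> L" "A \<noteq> B" "a A > 0" "b B > 0"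
      by blast
    have a0: "a V = 0" if "V \<in> L" "V \<noteq> A" for V
      using a_unique[of V A] AB that nonneg(1)[of V] by force
    have b0: "b V = 0" if "V \<in> L" "V \<noteq> B" for V
      using b_unique[of V B] AB that nonneg(2)[of V] by force
    have "(\<Sum>V\<in>L. \<bar>a V - b V\<bar>) = (\<Sum>V\<in>{A, B}. \<bar>a V - b V\<bar>)"
      by (rule sum.mono_neutral_right) (use AB finite_L a0 b0 in auto)
    also have "\<dots> = a A + b B"
      using AB a0[of B] b0[of A] by simp
    also have "\<dots> \<le> s * d x y"
      using bump_heights_le[of A B x y] AB by (simp add: a_def b_def)
    finally show ?thesis .
  next
    case False
    have single: "\<bar>a V - b V\<bar> \<le> s * d x y" for V
    proof -
      have "\<bar>a V - b V\<bar> \<le> \<bar>s * (d x (v V) - d y (v V))\<bar>"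
        unfolding a_def b_def right_diff_distrib by (rule bump_diff_le)
      also have "\<dots> = s * \<bar>d x (v V) - d y (v V)\<bar>"
        using s_nonneg by (simp add: abs_mult)
      also have "\<dots> \<le> s * d x y"
        using d_triangle[of x "v V" y] d_triangle[of y "v V" x] d_commute[of x y] s_nonneg
        by (intro mult_left_mono) auto
      finally show ?thesis .
    qed
    define S where "S = {V \<in> L. a V \<noteq> 0 \<or> b V \<noteq> 0}"
    have unique: "V = W" if "V \<in> S" "W \<in> S" for V W
      using that False a_unique[of V W] b_unique[of V W] nonneg[of V] nonneg[of W]
      unfolding S_def less_le mem_Collect_eq by metis
    have "(\<Sum>V\<in>L. \<bar>a V - b V\<bar>) = (\<Sum>V\<in>S. \<bar>a V - b V\<bar>)"
      by (rule sum.mono_neutral_right) (use finite_L in \<open>auto simp: S_def\<close>)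
    also have "\<dots> \<le> s * d x y"
    proof (cases "S = {}")
      case True
      then show ?thesis
        using s_nonneg assms(3) by simp
    next
      case False
      then obtain A where "S = {A}"
        using unique by blast
      then show ?thesis
        using single[of A] by simp
    qed
    finally show ?thesis .
  qed
  then show ?thesis
    by (simp add: a_def b_def)
qed

end

section \<open>The norm on the parameter space\<close>

text \<open>
  The value \<open>0\<close> is inserted in order that the maximum be a seminorm also for \<open>I = {}\<close>.
\<close>
definition sup_seminorm :: "nat set \<Rightarrow> (nat \<Rightarrow> real) \<Rightarrow> real" where
  "sup_seminorm I y = Max (insert 0 ((\<lambda>i. \<bar>y i\<bar>) ` I))"

lemma sup_seminorm_le_iff:
  assumes "finite I"
  shows "sup_seminorm I y \<le> r \<longleftrightarrow> 0 \<le> r \<and> (\<forall>i\<in>I. \<bar>y i\<bar> \<le> r)"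
  using assms by (simp add: sup_seminorm_def)

lemma sup_seminorm_nonneg: "finite I \<Longrightarrow> 0 \<le> sup_seminorm I y"
  by (simp add: sup_seminorm_def)

lemma abs_le_sup_seminorm: "finite I \<Longrightarrow> i \<in> I \<Longrightarrow> \<bar>y i\<bar> \<le> sup_seminorm I y"
  using sup_seminorm_le_iff by blast

lemma sup_seminorm_triangle:
  assumes "finite I"
  shows "sup_seminorm I (\<lambda>i. y i + z i) \<le> sup_seminorm I y + sup_seminorm I z"
  unfolding sup_seminorm_le_iff[OF assms]
  using abs_le_sup_seminorm[OF assms] sup_seminorm_nonneg[OF assms]
  by (auto intro!: add_nonneg_nonneg order_trans[OF abs_triangle_ineq] add_mono)

lemma sup_seminorm_scale_le:
  assumes "finite I"
  shows "sup_seminorm I (\<lambda>i. c * y i) \<le> \<bar>c\<bar> * sup_seminorm I y"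
  unfolding sup_seminorm_le_iff[OF assms]
  using abs_le_sup_seminorm[OF assms] sup_seminorm_nonneg[OF assms]
  by (auto simp: abs_mult intro!: mult_left_mono)

lemma sup_seminorm_scale:
  assumes "finite I"
  shows "sup_seminorm I (\<lambda>i. c * y i) = \<bar>c\<bar> * sup_seminorm I y"
proof (cases "c = 0")
  case True
  then show ?thesis
    using sup_seminorm_scale_le[OF assms, of 0 y] sup_seminorm_nonneg[OF assms, of "\<lambda>i. 0"]
    by simp
next
  case False
  \<comment> \<open>The lower bound is the upper bound for the inverse factor.\<close>
  have "sup_seminorm I y \<le> \<bar>inverse c\<bar> * sup_seminorm I (\<lambda>i. c * y i)"
    using sup_seminorm_scale_le[OF assms, of "inverse c" "\<lambda>i. c * y i"] False
    by (simp add: mult.assoc[symmetric])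
  then have "\<bar>c\<bar> * sup_seminorm I y \<le> sup_seminorm I (\<lambda>i. c * y i)"
    using False by (simp add: abs_inverse field_simps)
  then show ?thesis
    using sup_seminorm_scale_le[OF assms, of c y] by linarith
qed

definition l2_sup_norm :: "nat \<Rightarrow> nat \<Rightarrow> (nat \<Rightarrow> real) \<Rightarrow> real" where
  "l2_sup_norm n m y = max (L2_set y {..<n}) (sup_seminorm {n..<n + m} y)"

lemma norm_on_Rk_l2_sup_norm: "norm_on_Rk (n + m) (l2_sup_norm n m)"
  unfolding norm_on_Rk_def
proof (intro conjI ballI allI)
  fix y :: "nat \<Rightarrow> real" assume y: "y \<in> topspace (Euclidean_space (n + m))"
  show "0 \<le> l2_sup_norm n m y"
    by (simp add: l2_sup_norm_def L2_set_nonneg le_max_iff_disj)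
  show "l2_sup_norm n m y = 0 \<longleftrightarrow> y = (\<lambda>i. 0)"
  proof
    assume "l2_sup_norm n m y = 0"
    then have l2: "L2_set y {..<n} = 0" and sup: "sup_seminorm {n..<n + m} y \<le> 0"
      using L2_set_nonneg[of y "{..<n}"] unfolding l2_sup_norm_def by linarith+
    have "y i = 0" for i
    proof -
      consider "i < n" | "i \<in> {n..<n + m}" | "n + m \<le> i"
        by fastforce
      then show ?thesis
        using l2 sup y by cases (auto simp: L2_set_eq_0_iff sup_seminorm_le_iff topspace_Euclidean_space)
    qed
    then show "y = (\<lambda>i. 0)"
      by blast
  next
    assume "y = (\<lambda>i. 0)"
    then show "l2_sup_norm n m y = 0"
      using sup_seminorm_scale[of "{n..<n + m}" 0] by (simp add: l2_sup_norm_def L2_set_def)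
  qed
  show "l2_sup_norm n m (\<lambda>i. c * y i) = \<bar>c\<bar> * l2_sup_norm n m y" for c
  proof -
    have "L2_set (\<lambda>i. c * y i) {..<n} = \<bar>c\<bar> * L2_set y {..<n}"
      by (simp add: L2_set_def power_mult_distrib real_sqrt_mult flip: sum_distrib_left)
    then show ?thesis
      by (simp add: l2_sup_norm_def sup_seminorm_scale max_mult_distrib_left)
  qed
  show "l2_sup_norm n m (\<lambda>i. y i + z i) \<le> l2_sup_norm n m y + l2_sup_norm n m z" for z
    using L2_set_triangle_ineq[of y z "{..<n}"] sup_seminorm_triangle[of "{n..<n + m}" y z]
    unfolding l2_sup_norm_def max_def by auto
qed

section \<open>Lipschitz widths from separated codes\<close>

text \<open>
  The parameter that reaches the projection of \<open>f\<close> to \<open>V\<close> consists of the Fourier coefficients of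
  \<open>f\<close>, which lie in the unit ball by Bessel's inequality, and of the code word of \<open>V\<close>, at which the
  bump of \<open>V\<close> equals \<open>1\<close> and all others vanish.
\<close>
theorem lipschitz_width_le_separated_codes:
  fixes K :: "'h::real_inner set" and L :: "'h set set" and v :: "'h set \<Rightarrow> nat \<Rightarrow> real"
  assumes n: "n \<ge> 1" and finite_L: "finite L"
    and L: "\<And>V. V \<in> L \<Longrightarrow> subspace V \<and> dim V = n"
    and K: "\<And>f. f \<in> K \<Longrightarrow> norm f \<le> 1"
    and s: "s \<ge> 0"
    and cube: "\<And>V i. V \<in> L \<Longrightarrow> i \<in> {n..<n + m} \<Longrightarrow> \<bar>v V i\<bar> \<le> 1"
    and separated: "\<And>V W. V \<in> L \<Longrightarrow> W \<in> L \<Longrightarrow> V \<noteq> W \<Longrightarrow>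
           2 \<le> s * sup_seminorm {n..<n + m} (\<lambda>i. v V i - v W i)"
  shows "lipschitz_width (1 + s) (n + m) K \<le> (SUP f\<in>K. INF V\<in>L. ennreal (infdist f V))"
proof -
  let ?q = "sup_seminorm {n..<n + m}" and ?p = "l2_sup_norm n m"
  define d where "d y z = ?q (\<lambda>i. y i - z i)" for y z
  have d_nonneg: "d y z \<ge> 0" for y z
    by (simp add: d_def sup_seminorm_nonneg)
  have d_commute: "d y z = d z y" for y z
    using sup_seminorm_scale[of "{n..<n + m}" "-1" "\<lambda>i. y i - z i"] by (simp add: d_def)
  have d_refl: "d y y = 0" for y
    using sup_seminorm_scale[of "{n..<n + m}" 0] by (simp add: d_def)
  have d_triangle: "d x z \<le> d x y + d y z" for x y z
    using sup_seminorm_triangle[of "{n..<n + m}" "\<lambda>i. x i - y i" "\<lambda>i. y i - z i"]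
    by (simp add: d_def)
  have sep: "2 \<le> s * d (v V) (v W)" if "V \<in> L" "W \<in> L" "V \<noteq> W" for V W
    using separated[OF that] by (simp add: d_def)

  have "\<exists>e::nat \<Rightarrow> 'h. (\<forall>i<n. \<forall>j<n. e i \<bullet> e j = (if i = j then 1 else 0)) \<and> V = span (e ` {..<n})"
    if "V \<in> L" for V
    using orthonormal_basis_of_dim[of V n] L[OF that] n by metis
  then obtain e :: "'h set \<Rightarrow> nat \<Rightarrow> 'h"
    where ortho: "\<And>V i j. V \<in> L \<Longrightarrow> i < n \<Longrightarrow> j < n \<Longrightarrow> e V i \<bullet> e V j = (if i = j then 1 else 0)"
      and span: "\<And>V. V \<in> L \<Longrightarrow> V = span (e V ` {..<n})"
    by metis
  define U where "U V y = (\<Sum>i<n. y i *\<^sub>R e V i)" for V and y :: "nat \<Rightarrow> real"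
  have norm_U: "norm (U V y) = L2_set y {..<n}" if "V \<in> L" for V y
    unfolding U_def by (intro norm_orthonormal_combination ortho that)
  have U_diff: "U V y - U V z = U V (\<lambda>i. y i - z i)" for V y z
    by (simp add: U_def scaleR_left_diff_distrib sum_subtractf)
  define h where "h V y = bump (s * d y (v V))" for V y
  define \<Phi> where "\<Phi> y = (\<Sum>V\<in>L. h V y *\<^sub>R U V y)" for y

  have "norm (\<Phi> y - \<Phi> z) \<le> (1 + s) * ?p (\<lambda>i. y i - z i)" if y: "y \<in> unit_ball_Rk (n + m) ?p" for y z
  proof -
    have y1: "L2_set y {..<n} \<le> 1"
      using y by (simp add: unit_ball_Rk_def l2_sup_norm_def)
    \<comment> \<open>Varying the bumps first, at fixed \<open>y\<close>, leaves the factors \<open>U V y\<close> of norm at most \<open>1\<close>.\<close>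
    have decomposition: "\<Phi> y - \<Phi> z = (\<Sum>V\<in>L. (h V y - h V z) *\<^sub>R U V y) + (\<Sum>V\<in>L. h V z *\<^sub>R U V (\<lambda>i. y i - z i))"
      unfolding \<Phi>_def sum_subtractf[symmetric] sum.distrib[symmetric] U_diff[symmetric]
      by (intro sum.cong) (simp_all add: algebra_simps)
    have "norm (\<Phi> y - \<Phi> z)
        \<le> norm (\<Sum>V\<in>L. (h V y - h V z) *\<^sub>R U V y) + norm (\<Sum>V\<in>L. h V z *\<^sub>R U V (\<lambda>i. y i - z i))"
      unfolding decomposition by (rule norm_triangle_ineq)
    also have "norm (\<Sum>V\<in>L. (h V y - h V z) *\<^sub>R U V y) \<le> (\<Sum>V\<in>L. \<bar>h V y - h V z\<bar>)"
      using y1 by (intro sum_norm_le) (auto simp: norm_U intro: mult_left_le)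
    also have "\<dots> \<le> s * d y z"
      unfolding h_def
      by (rule sum_abs_diff_bump_le[where d = d])
        (fact d_commute d_triangle s finite_L sep d_refl d_nonneg)+
    also have "\<dots> \<le> s * ?p (\<lambda>i. y i - z i)"
      using s by (intro mult_left_mono) (simp_all add: d_def l2_sup_norm_def)
    also have "norm (\<Sum>V\<in>L. h V z *\<^sub>R U V (\<lambda>i. y i - z i))
        \<le> (\<Sum>V\<in>L. h V z * L2_set (\<lambda>i. y i - z i) {..<n})"
      by (intro sum_norm_le) (auto simp: norm_U h_def bump_def)
    also have "\<dots> = (\<Sum>V\<in>L. h V z) * L2_set (\<lambda>i. y i - z i) {..<n}"
      by (simp add: sum_distrib_right)
    also have "\<dots> \<le> 1 * ?p (\<lambda>i. y i - z i)"
    proof (intro mult_mono)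
      show "(\<Sum>V\<in>L. h V z) \<le> 1"
        unfolding h_def
        by (rule sum_bump_le_1[where d = d])
          (fact d_commute d_triangle s finite_L sep d_refl | rule d_nonneg)+
    qed (simp_all add: l2_sup_norm_def L2_set_nonneg)
    finally show ?thesis
      by (simp add: algebra_simps)
  qed
  then have \<Phi>_lipschitz: "\<Phi> \<in> lipschitz_maps (1 + s) (n + m) ?p"
    by (simp add: lipschitz_maps_def)

  have reached: "\<exists>y\<in>unit_ball_Rk (n + m) ?p. norm (f - \<Phi> y) \<le> infdist f V"
    if f: "f \<in> K" and V: "V \<in> L" for f V
  proof -
    define y where "y i = (if i < n then f \<bullet> e V i else if i < n + m then v V i else 0)" for i
    have "L2_set y {..<n} = L2_set (\<lambda>i. f \<bullet> e V i) {..<n}"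
      by (intro L2_set_cong) (auto simp: y_def)
    also have "\<dots> \<le> 1"
      using bessel_inequality[of n "e V" f] ortho[OF V] K[OF f] by force
    finally have "y \<in> unit_ball_Rk (n + m) ?p"
      using cube[OF V]
      by (auto simp: unit_ball_Rk_def topspace_Euclidean_space l2_sup_norm_def
          sup_seminorm_le_iff y_def)
    moreover have "d y (v W) = d (v V) (v W)" for W
      unfolding d_def sup_seminorm_def by (simp add: y_def image_def)
    then have "h W y = (if W = V then 1 else 0)" if "W \<in> L" for W
      using sep[OF V that] by (cases "W = V") (simp_all add: h_def bump_def d_refl)
    then have "\<Phi> y = (\<Sum>W\<in>L. if W = V then U V y else 0)"
      unfolding \<Phi>_def by (intro sum.cong) auto
    then have "\<Phi> y = (\<Sum>i<n. (f \<bullet> e V i) *\<^sub>R e V i)"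
      using V finite_L by (simp add: U_def y_def)
    then have "norm (f - \<Phi> y) \<le> infdist f V"
      using norm_projection_residual_le_infdist[of n "e V" f] ortho[OF V] span[OF V] by simp
    ultimately show ?thesis
      by blast
  qed

  have "lipschitz_width (1 + s) (n + m) K \<le> fixed_lipschitz_width (1 + s) (n + m) ?p K"
    unfolding lipschitz_width_def using n norm_on_Rk_l2_sup_norm
    by (intro INF_lower2[of "n + m"] INF_lower) auto
  also have "\<dots> \<le> (SUP f\<in>K. INF y\<in>unit_ball_Rk (n + m) ?p. ennreal (norm (f - \<Phi> y)))"
    unfolding fixed_lipschitz_width_def by (rule INF_lower[OF \<Phi>_lipschitz])
  also have "\<dots> \<le> (SUP f\<in>K. INF V\<in>L. ennreal (infdist f V))"
    by (intro SUP_subset_mono subset_refl INF_mono) (use reached ennreal_leI in blast)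
  finally show ?thesis .
qed

text \<open>
  The segment \<open>[-1, 1]\<close> has room for the points \<open>-1 + 2 * j / N\<close>, \<open>j < card L \<le> N\<close>, as code.
\<close>
lemma lipschitz_width_le_segment:
  fixes K :: "'h::real_inner set"
  assumes "n \<ge> 1" "finite L" "real (card L) \<le> N" "N > 0"
    and L: "\<And>V. V \<in> L \<Longrightarrow> subspace V \<and> dim V = n"
    and K: "\<And>f. f \<in> K \<Longrightarrow> norm f \<le> 1"
  shows "lipschitz_width (N + 1) (n + 1) K \<le> (SUP f\<in>K. INF V\<in>L. ennreal (infdist f V))"
proof -
  obtain g :: "'h set \<Rightarrow> nat" where g: "inj_on g L" "g ` L \<subseteq> {..<card L}"
    using inj_on_iff_card_le[of L "{..<card L}"] assms(2) by auto
  define v :: "'h set \<Rightarrow> nat \<Rightarrow> real" where "v V i = 2 * real (g V) / N - 1" for V i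
  have "lipschitz_width (1 + N) (n + 1) K \<le> (SUP f\<in>K. INF V\<in>L. ennreal (infdist f V))"
  proof (rule lipschitz_width_le_separated_codes[OF assms(1,2) L K, where v = v])
    show "\<bar>v V i\<bar> \<le> 1" if "V \<in> L" for V i
    proof -
      have "g V < card L"
        using g(2) that by auto
      then have "real (g V) \<le> N"
        using assms(3) by linarith
      then show ?thesis
        using assms(4) by (auto simp: v_def abs_le_iff field_simps)
    qed
    show "2 \<le> N * sup_seminorm {n..<n + 1} (\<lambda>i. v V i - v W i)"
      if "V \<in> L" "W \<in> L" "V \<noteq> W" for V W
    proof -
      have "g V \<noteq> g W"
        using g(1) that by (auto simp: inj_on_def)
      then have "2 \<le> \<bar>2 * real (g V) - 2 * real (g W)\<bar>"
        by linarith
      also have "2 * real (g V) - 2 * real (g W) = N * (v V n - v W n)"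
        using assms(4) by (simp add: v_def field_simps)
      also have "\<bar>N * (v V n - v W n)\<bar> = N * \<bar>v V n - v W n\<bar>"
        using assms(4) by (simp add: abs_mult)
      also have "\<dots> \<le> N * sup_seminorm {n..<n + 1} (\<lambda>i. v V i - v W i)"
        using assms(4) abs_le_sup_seminorm[of "{n..<n + 1}" n "\<lambda>i. v V i - v W i"]
        by (intro mult_left_mono) auto
      finally show ?thesis .
    qed
  qed (use assms(4) in auto)
  then show ?thesis
    by (simp add: add.commute)
qed

text \<open>
  The code consists of vertices of the cube, that is, of sign vectors, given by the set of
  coordinates in which they are positive.
\<close>
lemma lipschitz_width_le_cube:
  fixes K :: "'h::real_inner set"
  assumes "n \<ge> 1" "finite L" "card L \<le> 2 ^ m"
    and L: "\<And>V. V \<in> L \<Longrightarrow> subspace V \<and> dim V = n"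
    and K: "\<And>f. f \<in> K \<Longrightarrow> norm f \<le> 1"
  shows "lipschitz_width 3 (n + m) K \<le> (SUP f\<in>K. INF V\<in>L. ennreal (infdist f V))"
proof -
  obtain c :: "'h set \<Rightarrow> nat set" where c: "inj_on c L" "c ` L \<subseteq> Pow {n..<n + m}"
    using inj_on_iff_card_le[of L "Pow {n..<n + m}"] assms(2,3) by (auto simp: card_Pow)
  define v :: "'h set \<Rightarrow> nat \<Rightarrow> real" where "v V i = (if i \<in> c V then 1 else -1)" for V i
  have "lipschitz_width (1 + 2) (n + m) K \<le> (SUP f\<in>K. INF V\<in>L. ennreal (infdist f V))"
  proof (rule lipschitz_width_le_separated_codes[OF assms(1,2) L K, where v = v])
    show "\<bar>v V i\<bar> \<le> 1" for V i
      by (simp add: v_def)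
    show "2 \<le> 2 * sup_seminorm {n..<n + m} (\<lambda>i. v V i - v W i)"
      if "V \<in> L" "W \<in> L" "V \<noteq> W" for V W
    proof -
      have "c V \<noteq> c W"
        using c(1) that by (auto simp: inj_on_def)
      then obtain i where i: "i \<in> c V \<longleftrightarrow> i \<notin> c W"
        by blast
      moreover have "i \<in> {n..<n + m}"
        using i c(2) that(1,2) by blast
      ultimately have "2 \<le> sup_seminorm {n..<n + m} (\<lambda>i. v V i - v W i)"
        using abs_le_sup_seminorm[of "{n..<n + m}" i "\<lambda>i. v V i - v W i"]
        by (auto simp: v_def split: if_splits)
      then show ?thesis
        by simp
    qed
  qed auto
  then show ?thesis
    by simp
qed

theorem lemma3p2:
  fixes K :: "'h::{real_inner, complete_space} set"
    and n :: nat and N :: real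
  assumes "n \<ge> 1" and "N > 1" and "compact K"
    and "(SUP f\<in>K. ennreal (norm f)) = 1"
  shows "lipschitz_width (N + 1) (n + 1) K \<le> nonlinear_kolmogorov_width n N K \<and>
         lipschitz_width 3 (n + nat \<lceil>log 2 N\<rceil>) K \<le> nonlinear_kolmogorov_width n N K"
proof -
  have K: "norm f \<le> 1" if "f \<in> K" for f
    using SUP_upper[OF that, of "\<lambda>f. ennreal (norm f)"] assms(4) by simp
  define m where "m = nat \<lceil>log 2 N\<rceil>"
  have "log 2 N \<le> real m"
    unfolding m_def by (rule real_nat_ceiling_ge)
  then have N_le: "N \<le> 2 ^ m"
    using assms(2) by (simp add: log_le_iff powr_realpow)
  have "card L \<le> 2 ^ m" if "real (card L) \<le> N" for L :: "'h set set"
  proof -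
    have "real (card L) \<le> 2 ^ m"
      using that N_le by linarith
    then show ?thesis
      by (metis of_nat_le_iff of_nat_numeral of_nat_power)
  qed
  then have "lipschitz_width 3 (n + m) K \<le> nonlinear_kolmogorov_width n N K"
    unfolding nonlinear_kolmogorov_width_def using assms(1) K
    by (intro INF_greatest lipschitz_width_le_cube) auto
  moreover have "lipschitz_width (N + 1) (n + 1) K \<le> nonlinear_kolmogorov_width n N K"
    unfolding nonlinear_kolmogorov_width_def using assms(1,2) K
    by (intro INF_greatest lipschitz_width_le_segment) auto
  ultimately show ?thesis
    by (simp add: m_def)
qed

end
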